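(* Let $n,k,t$ be positive integers with $n\geq k>t$ and $n\geq 3(t+2)^3k^2$, and let $\mathcal{F}\subset\binom{[n]}{k}$ be a $t$-intersecting family. Then $$|\mathcal{I}(\mathcal{F})|\leq |\mathcal{I}(\mathcal{A}(n,k,t))|.$$
   Context: $[n]=\{1,2,\ldots,n\}$ and $\binom{[n]}{k}$ is the collection of all $k$-element subsets of $[n]$. A family $\mathcal{F}\subset\binom{[n]}{k}$ is $t$-intersecting if $|F\cap F'|\geq t$ for all $F,F'\in\mathcal{F}$. Define $\mathcal{I}(\mathcal{F})=\{F\cap F'\colon F,F'\in\mathcal{F},\,F\neq F'\}$, and $$\mathcal{A}(n,k,t)=\left\{A\in\binom{[n]}{k}\colon |A\cap[t+2]|\geq t+1\right\}.$$ *)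

theory Defs
  imports Main "HOL-Library.Ramsey"
begin

definition t_intersecting :: "nat \<Rightarrow> 'a set set \<Rightarrow> bool" where
  "t_intersecting t \<F> \<longleftrightarrow> (\<forall>F\<in>\<F>. \<forall>F'\<in>\<F>. t \<le> card (F \<inter> F'))"

definition intersections :: "'a set set \<Rightarrow> 'a set set" where
  "intersections \<F> = {F \<inter> F' | F F'. F \<in> \<F> \<and> F' \<in> \<F> \<and> F \<noteq> F'}"

definition frankl_family :: "nat \<Rightarrow> nat \<Rightarrow> nat \<Rightarrow> nat set set" where
  "frankl_family n k t = {A \<in> nsets {1..n} k. t + 1 \<le> card (A \<inter> {1..t + 2})}"

end

theory Submission
  imports Defs Complex_Main
begin

text \<open>
  Enlarge the family to a maximal \<open>t\<close>-intersecting family \<open>U\<close> of sets of size at most \<open>k\<close>,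
  and let the bases be the inclusion-minimal members of \<open>U\<close>. Every member contains a base, and
  every base meets every member in at least \<open>t\<close> points. Write \<open>S\<close> for the number of subsets of
  size at most \<open>k - t - 1\<close> of a set of \<open>n - t - 2\<close> points. The extremal family has at least
  \<open>(t + 2 choose 2) * S\<close> distinct intersections (\<open>card_intersections_frankl_ge\<close>): every
  \<open>t\<close>-subset of \<open>{1..t + 2}\<close> can be completed by any small set outside.

  Suppose first that no \<open>t\<close>-set lies in all bases of size at most \<open>t + 1\<close>. Then three of these
  bases are \<open>(t + 1)\<close>-subsets of a single \<open>(t + 2)\<close>-set \<open>W\<close>, and a member missing two points of
  \<open>W\<close> would meet one of the three too little. So the family lies in a copy of the extremal one
  (\<open>concentrated_on_small_set\<close>).

  Otherwise let \<open>r \<ge> t + 2\<close> be maximal such that some \<open>t\<close>-set \<open>T\<close> lies in all bases of size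
  below \<open>r\<close>. Consider an intersection of two members, each containing a base. If both bases are
  smaller than \<open>r\<close>, the intersection contains \<open>T\<close>; this yields at most \<open>2 * S\<close> sets. If
  one base \<open>B\<close> has size \<open>l \<ge> r\<close>, the intersection consists of at least \<open>t\<close> points of \<open>B\<close> and
  at most \<open>k - l\<close> points outside \<open>B\<close> (\<open>card_intersections_le\<close>). Branching over sets that must be
  hit gives few bases of size \<open>l\<close>: choose \<open>t\<close> points of a base of size at most \<open>r\<close>; these \<open>t\<close>
  points miss part of another base of size at most \<open>r\<close>, so \<open>r\<close> choices suffice for the next
  point; each later point costs \<open>k\<close> choices, because a proper subset of a base fails to
  \<open>t\<close>-intersect some member. Hence there are at most \<open>(r choose t) * r * k ^ (l - t - 1)\<close> bases of
  size \<open>l\<close> (\<open>card_bases_of_size\<close>). The exponent \<open>l - t - 1\<close>, rather than \<open>l - t\<close>, is what makes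
  \<open>n\<close> of order \<open>k\<^sup>2\<close> sufficient: each of these \<open>l - t - 1\<close> factors \<open>k\<close> comes with one step
  down in the size of the remaining part, which gains a factor of order \<open>n / k\<close>. Summing
  over \<open>l\<close> gives at most \<open>7 / 24 * (t + 2 choose 2) * S\<close>, and
  \<open>2 \<le> 2 / 3 * (t + 2 choose 2)\<close> leaves room for the intersections that contain \<open>T\<close>.
\<close>

section \<open>Partial sums of binomial coefficients\<close>

definition binom_sum :: "nat \<Rightarrow> nat \<Rightarrow> nat" where
  "binom_sum m j = (\<Sum>i\<le>j. m choose i)"

lemma card_small_subsets:
  assumes "finite A"
  shows "card {Z. Z \<subseteq> A \<and> card Z \<le> j} = binom_sum (card A) j"
proof -
  have "{Z. Z \<subseteq> A \<and> card Z \<le> j} = (\<Union>i\<le>j. {Z. Z \<subseteq> A \<and> card Z = i})"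
    by auto
  also have "card \<dots> = (\<Sum>i\<le>j. card {Z. Z \<subseteq> A \<and> card Z = i})"
    using assms by (intro card_UN_disjoint) auto
  finally show ?thesis
    by (simp add: binom_sum_def n_subsets[OF assms])
qed

lemma card_large_subsets:
  assumes "finite A"
  shows "card {Y. Y \<subseteq> A \<and> t \<le> card Y} \<le> binom_sum (card A) (card A - t)"
proof -
  have "inj_on (\<lambda>Y. A - Y) {Y. Y \<subseteq> A \<and> t \<le> card Y}"
    by (rule inj_onI) blast
  moreover have "(\<lambda>Y. A - Y) ` {Y. Y \<subseteq> A \<and> t \<le> card Y} \<subseteq> {Z. Z \<subseteq> A \<and> card Z \<le> card A - t}"
    using assms by (auto simp: card_Diff_subset finite_subset)
  moreover have "finite {Z. Z \<subseteq> A \<and> card Z \<le> card A - t}"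
    using assms by simp
  ultimately have "card {Y. Y \<subseteq> A \<and> t \<le> card Y} \<le> card {Z. Z \<subseteq> A \<and> card Z \<le> card A - t}"
    by (rule card_inj_on_le)
  then show ?thesis
    by (simp only: card_small_subsets[OF assms])
qed

lemma binom_sum_0 [simp]: "binom_sum m 0 = 1"
  by (simp add: binom_sum_def)

lemma binom_sum_Suc: "binom_sum m (Suc j) = binom_sum m j + (m choose Suc j)"
  by (simp add: binom_sum_def)

lemma binom_sum_Pascal: "binom_sum (Suc m) (Suc j) = binom_sum m (Suc j) + binom_sum m j"
  by (induction j) (simp_all add: binom_sum_Suc)

lemma binom_sum_mono:
  assumes "m \<le> m'" "j \<le> j'"
  shows "binom_sum m j \<le> binom_sum m' j'"
proof -
  have "binom_sum m j \<le> binom_sum m' j"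
    unfolding binom_sum_def using assms(1) by (intro sum_mono binomial_right_mono)
  also have "\<dots> \<le> binom_sum m' j'"
    unfolding binom_sum_def using assms(2) by (intro sum_mono2) auto
  finally show ?thesis .
qed

lemma binom_sum_ratio:
  assumes "c * Suc j \<le> m - j"
  shows "c * binom_sum m j \<le> binom_sum m (Suc j)"
  using assms
proof (induction j)
  case 0
  then show ?case by (simp add: binom_sum_Suc)
next
  case (Suc j)
  have step: "c * (m choose Suc j) \<le> m choose Suc (Suc j)"
  proof -
    have "(c * (m choose Suc j)) * Suc (Suc j) = (c * Suc (Suc j)) * (m choose Suc j)"
      by (simp only: ac_simps)
    also have "\<dots> \<le> (m - Suc j) * (m choose Suc j)"
      using Suc.prems by (rule mult_right_mono) simp
    also have "\<dots> = (m choose Suc (Suc j)) * Suc (Suc j)"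
      by (metis binomial_absorb_comp binomial_absorption mult.commute)
    finally show ?thesis by (simp only: mult_le_cancel2 zero_less_Suc simp_thms)
  qed
  have "c * Suc j \<le> m - j"
    using Suc.prems by simp
  then have "c * binom_sum m j \<le> binom_sum m (Suc j)"
    by (rule Suc.IH)
  then show ?case
    using step by (simp add: binom_sum_Suc distrib_left)
qed

lemma binom_sum_geometric:
  assumes "\<And>i. i < j \<Longrightarrow> c * binom_sum m i \<le> binom_sum m (Suc i)" and "a \<le> j"
  shows "c ^ a * binom_sum m (j - a) \<le> binom_sum m j"
  using assms(2)
proof (induction a)
  case (Suc a)
  have "c ^ Suc a * binom_sum m (j - Suc a) = c ^ a * (c * binom_sum m (j - Suc a))"
    by simp
  also have "\<dots> \<le> c ^ a * binom_sum m (j - a)"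
    using assms(1)[of "j - Suc a"] Suc.prems by (intro mult_left_mono) (simp_all add: Suc_diff_Suc)
  also have "\<dots> \<le> binom_sum m j"
    using Suc by simp
  finally show ?case .
qed simp

lemma binom_sum_add_2_le:
  assumes "j > 0 \<Longrightarrow> 3 * binom_sum m (j - 1) \<le> binom_sum m j"
  shows "binom_sum (m + 2) j \<le> 2 * binom_sum m j"
proof (cases j)
  case (Suc i)
  have a: "binom_sum (Suc m) i \<le> 2 * binom_sum m i"
  proof (cases i)
    case (Suc h)
    have "binom_sum m h \<le> binom_sum m (Suc h)"
      by (rule binom_sum_mono) simp_all
    then show ?thesis by (simp add: Suc binom_sum_Pascal)
  qed simp
  have "binom_sum (m + 2) j = binom_sum m j + binom_sum m i + binom_sum (Suc m) i"
    by (simp add: Suc binom_sum_Pascal)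
  then show ?thesis using assms a Suc by simp
qed simp

section \<open>Numerical estimates\<close>

text \<open>
  The next three lemmas control the \<open>t\<close>-dependent factors for a base of size \<open>t + m\<close>: both the
  branching factor and the number of traces on the base grow by a factor of at most \<open>t + 2\<close>
  when \<open>m\<close> grows by one. Together these \<open>(t + 2)\<^sup>2\<close> stay below the gain \<open>3 * (t + 2) ^ 3\<close>
  provided by the lower bound on the size of the ground set.
\<close>

lemma binom_sum_diagonal_step:
  assumes "2 \<le> m"
  shows "binom_sum (t + Suc m) (Suc m) \<le> (t + 2) * binom_sum (t + m) m"
proof -
  have "3 * (t + m choose Suc m) \<le> Suc m * (t + m choose Suc m)"
    using assms by (intro mult_right_mono) simp_all
  also have "\<dots> = t * (t + m choose m)"
    by (metis add_diff_cancel_right' binomial_absorb_comp binomial_absorption)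
  also have "\<dots> \<le> t * binom_sum (t + m) m"
    unfolding binom_sum_def by (intro mult_left_mono member_le_sum) auto
  finally have "3 * (t + m choose Suc m) \<le> t * binom_sum (t + m) m" .
  moreover have "binom_sum (t + Suc m) (Suc m) = 2 * binom_sum (t + m) m + (t + m choose Suc m)"
    using binom_sum_Pascal[of "t + m" m] binom_sum_Suc[of "t + m" m] by simp
  ultimately show ?thesis by (simp add: algebra_simps)
qed

lemma binomial_diagonal_step:
  assumes "0 < t" "0 < m"
  shows "(t + Suc m choose t) * (t + Suc m) \<le> (t + 2) * ((t + m choose t) * (t + m))"
proof -
  have eq: "Suc m * (t + Suc m choose t) = (t + Suc m) * (t + m choose t)"
    using binomial_absorb_comp[of "t + Suc m" t] by simp
  have "(t + Suc m) * (t + Suc m) \<le> Suc m * (t + 2) * (t + m)"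
  proof -
    have "2 * (t + m) \<le> (m * t + m + 1) * (t + m)"
      using assms by (intro mult_right_mono) simp_all
    moreover have "(t + Suc m) * (t + Suc m) \<le> (t + Suc m) * (t + m) + 2 * (t + m)"
      using assms by simp
    moreover have "(t + Suc m) * (t + m) + (m * t + m + 1) * (t + m) = Suc m * (t + 2) * (t + m)"
      by (simp add: algebra_simps)
    ultimately show ?thesis by linarith
  qed
  have "Suc m * ((t + Suc m choose t) * (t + Suc m)) = (t + Suc m) * (t + Suc m) * (t + m choose t)"
    using arg_cong[OF eq, of "\<lambda>x. x * (t + Suc m)"] by (simp only: ac_simps)
  also have "\<dots> \<le> Suc m * (t + 2) * (t + m) * (t + m choose t)"
    using \<open>(t + Suc m) * (t + Suc m) \<le> Suc m * (t + 2) * (t + m)\<close> by (rule mult_right_mono) simp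
  also have "\<dots> = Suc m * ((t + 2) * ((t + m choose t) * (t + m)))"
    by (simp only: ac_simps)
  finally show ?thesis unfolding Suc_mult_le_cancel1 .
qed

lemma diagonal_product_bound:
  assumes "0 < t"
  shows "(t + 2 + i choose t) * (t + 2 + i) * binom_sum (t + 2 + i) (2 + i)
    \<le> (t + 2 choose 2) * (t + 2) * ((t + 2 choose 2) + t + 3) * ((t + 2)\<^sup>2) ^ i"
proof (induction i)
  case 0
  have "binom_sum p 2 = (p choose 2) + p + 1" for p
    using binom_sum_Suc[of p 1] binom_sum_Suc[of p 0] by (simp add: numeral_2_eq_2[symmetric])
  then have "binom_sum (t + 2) 2 = (t + 2 choose 2) + t + 3"
    by (simp del: binomial_Suc_Suc)
  moreover have "t + 2 choose t = t + 2 choose 2"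
    using binomial_symmetric[of t "t + 2"] by simp
  ultimately show ?case by simp
next
  case (Suc i)
  let ?c = "\<lambda>i. (t + 2 + i choose t) * (t + 2 + i)"
  let ?v = "\<lambda>i. binom_sum (t + 2 + i) (2 + i)"
  have eqs: "t + 2 + Suc i = t + Suc (2 + i)" "t + 2 + i = t + (2 + i)" "2 + Suc i = Suc (2 + i)"
    by simp_all
  have "?c (Suc i) * ?v (Suc i) \<le> ((t + 2) * ?c i) * ((t + 2) * ?v i)"
    unfolding eqs
    by (rule mult_mono[OF binomial_diagonal_step[OF assms] binom_sum_diagonal_step]) simp_all
  also have "\<dots> = (?c i * ?v i) * (t + 2)\<^sup>2"
    by (simp only: power2_eq_square ac_simps)
  also have "\<dots> \<le> ((t + 2 choose 2) * (t + 2) * ((t + 2 choose 2) + t + 3) * ((t + 2)\<^sup>2) ^ i) * (t + 2)\<^sup>2"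
    using Suc.IH by (rule mult_right_mono) simp
  also have "\<dots> = (t + 2 choose 2) * (t + 2) * ((t + 2 choose 2) + t + 3) * ((t + 2)\<^sup>2) ^ Suc i"
    by (simp only: power_Suc ac_simps)
  finally show ?case .
qed

text \<open>
  This is where the lower bound on \<open>n\<close> enters: lowering the permitted size by one divides the
  count by at least \<open>3 * (t + 2) ^ 3 * k\<close>, which pays for one branching step and for the
  \<open>t\<close>-dependent factors.
\<close>

lemma binom_sum_grows:
  assumes "3 * (t + 2) ^ 3 * k\<^sup>2 \<le> n" "0 < t" "i < k - t - 1"
  shows "3 * (t + 2) ^ 3 * k * binom_sum (n - t - 2) i \<le> binom_sum (n - t - 2) (Suc i)"
proof (rule binom_sum_ratio)
  define q where "q = 3 * (t + 2) ^ 3 * k"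
  have "1 * k \<le> q"
    unfolding q_def by (rule mult_right_mono) simp_all
  then have "t + 2 + i \<le> q"
    using assms(3) by linarith
  moreover have "q * Suc i + q \<le> n"
  proof -
    have "q * Suc i + q = q * Suc (Suc i)"
      by simp
    also have "\<dots> \<le> q * k"
      using assms(3) by (intro mult_left_mono) linarith+
    also have "\<dots> \<le> n"
      using assms(1) by (simp add: q_def power2_eq_square mult.assoc)
    finally show ?thesis .
  qed
  ultimately show "3 * (t + 2) ^ 3 * k * Suc i \<le> n - t - 2 - i"
    unfolding q_def[symmetric] by linarith
qed

text \<open>
  The contribution of the bases of size \<open>l\<close>. With \<open>p = t + 2\<close> and \<open>c = p choose 2\<close>, the case
  \<open>l = p\<close> is bounded by \<open>c * (c + p + 1) / (3 * p\<^sup>2)\<close> times the main term, where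
  \<open>(c + p + 1) / p\<^sup>2 \<le> 7 / 9\<close> with equality at \<open>p = 3\<close>. Every further point of the base gains
  \<open>p\<^sup>2 / (3 * p ^ 3) \<le> 1 / 9\<close>.
\<close>

lemma tail_term_bound:
  assumes n: "3 * (t + 2) ^ 3 * k\<^sup>2 \<le> n" and "0 < t" and l: "t + 2 \<le> l" "l \<le> k"
  shows "real ((l choose t) * l * k ^ (l - t - 1) * (binom_sum l (l - t) * binom_sum (n - l) (k - l)))
    \<le> 7 / 27 * (t + 2 choose 2) * (1 / 9) ^ (l - (t + 2)) * binom_sum (n - t - 2) (k - t - 1)"
proof -
  define i where "i = l - (t + 2)"
  have l_def: "l = t + 2 + i"
    using l(1) by (simp add: i_def)
  have i: "t + 2 + i \<le> k"
    using l(2) by (simp only: l_def)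
  define p where "p = real (t + 2)"
  define c where "c = real (t + 2 choose 2)"
  define S where "S = real (binom_sum (n - t - 2) (k - t - 1))"
  define s where "s = real (binom_sum (n - t - 2) (k - l))"
  have p3: "3 \<le> p" using \<open>0 < t\<close> by (simp add: p_def)
  have k0: "0 < k" using i by simp
  have c: "2 * c = p * (p - 1)"
  proof -
    have "2 * (t + 2 choose 2) = (t + 2) * (t + 1)"
      using binomial_absorption[of 1 "t + 2"] by (simp only: Suc_1) simp
    then have "real (2 * (t + 2 choose 2)) = real ((t + 2) * (t + 1))"
      by (rule arg_cong)
    then show ?thesis by (simp add: c_def p_def algebra_simps del: binomial_Suc_Suc)
  qed
  have decay: "(3 * p ^ 3 * k) ^ Suc i * s \<le> S"
  proof -
    have "k - t - 1 - Suc i = k - l"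
      by (simp add: l_def)
    then have "(3 * (t + 2) ^ 3 * k) ^ Suc i * binom_sum (n - t - 2) (k - l) \<le> binom_sum (n - t - 2) (k - t - 1)"
      using binom_sum_geometric[of "k - t - 1" "3 * (t + 2) ^ 3 * k" "n - t - 2" "Suc i"]
        binom_sum_grows[OF n \<open>0 < t\<close>] i by simp
    then have "real ((3 * (t + 2) ^ 3 * k) ^ Suc i * binom_sum (n - t - 2) (k - l)) \<le> S"
      unfolding S_def by (rule of_nat_mono)
    then show ?thesis
      by (simp only: s_def p_def of_nat_mult of_nat_power of_nat_numeral)
  qed
  have "(l choose t) * l * binom_sum l (l - t) \<le> (t + 2 choose 2) * (t + 2) * ((t + 2 choose 2) + t + 3) * ((t + 2)\<^sup>2) ^ i"
    using diagonal_product_bound[OF \<open>0 < t\<close>, of i] by (simp only: l_def) simp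
  then have "real ((l choose t) * l * binom_sum l (l - t))
      \<le> real ((t + 2 choose 2) * (t + 2) * ((t + 2 choose 2) + t + 3) * ((t + 2)\<^sup>2) ^ i)"
    by (rule of_nat_mono)
  also have "\<dots> = c * p * (c + p + 1) * (p\<^sup>2) ^ i"
    by (simp add: c_def p_def algebra_simps del: binomial_Suc_Suc)
  finally have 1: "real ((l choose t) * l * binom_sum l (l - t)) \<le> c * p * (c + p + 1) * (p\<^sup>2) ^ i" .
  have "27 * (c + p + 1) \<le> 21 * p\<^sup>2"
  proof -
    (* After inserting 2 * c = p * (p - 1), twice the difference of the two sides is this product. *)
    have "0 \<le> (p - 3) * (15 * p + 18)" using p3 by simp
    then show ?thesis using c by (simp add: power2_eq_square algebra_simps)
  qed
  then have 2: "c + p + 1 \<le> 7 / 9 * p\<^sup>2" by simp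
  have "real ((l choose t) * l * k ^ (l - t - 1) * (binom_sum l (l - t) * binom_sum (n - l) (k - l)))
      = real ((l choose t) * l * binom_sum l (l - t)) * (real k ^ Suc i * binom_sum (n - l) (k - l))"
    by (simp add: l_def)
  also have "\<dots> \<le> (c * p * (c + p + 1) * (p\<^sup>2) ^ i) * (real k ^ Suc i * s)"
  proof -
    have "binom_sum (n - l) (k - l) \<le> binom_sum (n - t - 2) (k - l)"
      by (rule binom_sum_mono) (simp_all add: l_def)
    then show ?thesis
      using 1 p3 by (intro mult_mono) (simp_all add: s_def c_def)
  qed
  also have "\<dots> \<le> (c * p * (7 / 9 * p\<^sup>2) * (p\<^sup>2) ^ i) * (real k ^ Suc i * s)"
    using 2 p3 by (intro mult_right_mono mult_left_mono) (simp_all add: s_def c_def)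
  also have "\<dots> = 7 / 27 * c * (1 / (3 * p)) ^ i * ((3 * p ^ 3 * k) ^ Suc i * s)"
    using p3 by (simp add: field_simps power2_eq_square power3_eq_cube power_mult_distrib)
  also have "\<dots> \<le> 7 / 27 * c * (1 / 9) ^ i * S"
  proof (intro mult_mono)
    show "(1 / (3 * p)) ^ i \<le> (1 / 9) ^ i"
      using p3 by (intro power_mono) (simp_all add: field_simps)
  qed (use decay p3 in \<open>simp_all add: c_def S_def s_def\<close>)
  finally show ?thesis by (simp only: c_def S_def i_def)
qed

section \<open>Maximal intersecting families and their bases\<close>

text \<open>
  Members of every size up to \<open>k\<close> are admitted, not only \<open>k\<close>-sets: the small ones record why
  the family is \<open>t\<close>-intersecting. The bound \<open>k\<close> on the size is what limits the branching below.
\<close>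

locale saturated_family =
  fixes V :: "'a set" and k t :: nat and U :: "'a set set"
  assumes finite_V: "finite V"
    and member_subset: "X \<in> U \<Longrightarrow> X \<subseteq> V"
    and member_card: "X \<in> U \<Longrightarrow> card X \<le> k"
    and inter: "X \<in> U \<Longrightarrow> Y \<in> U \<Longrightarrow> t \<le> card (X \<inter> Y)"
    and saturated: "X \<subseteq> V \<Longrightarrow> card X \<le> k \<Longrightarrow> t \<le> card X \<Longrightarrow>
      (\<And>Y. Y \<in> U \<Longrightarrow> t \<le> card (X \<inter> Y)) \<Longrightarrow> X \<in> U"
begin

definition bases :: "'a set set" where
  "bases = {B \<in> U. \<forall>X\<in>U. X \<subseteq> B \<longrightarrow> X = B}"

lemma base_member: "B \<in> bases \<Longrightarrow> B \<in> U"
  by (simp add: bases_def)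

lemma finite_member: "X \<in> U \<Longrightarrow> finite X"
  using finite_V finite_subset member_subset by blast

lemma finite_U: "finite U"
  using finite_V member_subset by (meson Pow_iff finite_Pow_iff finite_subset subsetI)

lemma finite_bases: "finite bases"
  using finite_U by (simp add: bases_def)

lemma card_member_ge: "X \<in> U \<Longrightarrow> t \<le> card X"
  using inter[of X X] by simp

lemma base_below:
  assumes "X \<in> U"
  obtains B where "B \<in> bases" "B \<subseteq> X"
proof -
  obtain B where B: "B \<in> U" "B \<subseteq> X" "\<forall>Y\<in>U. Y \<subseteq> B \<longrightarrow> B = Y"
    using finite_has_minimal2[OF finite_U assms] by auto
  then have "B \<in> bases"
    unfolding bases_def by blast
  then show thesis
    using B(2) by (rule that)
qed

text \<open>
  A proper subset of a base is not a member, so by maximality some member obstructs it. If the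
  subset has fewer than \<open>t\<close> points, the base itself is such a member.
\<close>

lemma proper_subset_of_base:
  assumes "B \<in> bases" "X \<subset> B"
  obtains Y where "Y \<in> U" "card (X \<inter> Y) < t"
proof -
  have "B \<in> U" "X \<notin> U"
    using assms by (auto simp: bases_def)
  moreover have "X \<subseteq> V" "card X \<le> k"
    using assms member_subset[OF \<open>B \<in> U\<close>] member_card[OF \<open>B \<in> U\<close>]
      psubset_card_mono[OF finite_member[OF \<open>B \<in> U\<close>], of X] by auto
  ultimately have "card X < t \<or> (\<exists>Y\<in>U. card (X \<inter> Y) < t)"
    using saturated[of X] not_le by blast
  moreover have "X \<inter> B = X" using assms by blast
  ultimately show thesis
    using that \<open>B \<in> U\<close> by metis
qed

lemma branch:
  assumes "B \<in> U" "Y \<in> U" "card (X \<inter> Y) < t"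
  obtains v where "v \<in> Y - X" "v \<in> B"
proof -
  have "card (X \<inter> Y) < card (B \<inter> Y)"
    using assms inter[of B Y] by simp
  then have "\<not> B \<inter> Y \<subseteq> X \<inter> Y"
    using finite_member[OF assms(2)] by (meson card_mono finite_Int leD)
  then show thesis using that by blast
qed

text \<open>
  A branching process with \<open>j + 1\<close> steps after the choice of \<open>t\<close> points. The first step uses a
  base of size at most \<open>r\<close> not containing the chosen \<open>t\<close>-set and costs a factor \<open>r\<close>; every later
  step uses the member obstructing the current set and costs a factor \<open>k\<close>. A set without an
  obstructing member is discarded: the only base it can lie in is itself.
\<close>

lemma branching_family:
  assumes no_kernel: "\<And>T. T \<subseteq> V \<Longrightarrow> card T = t \<Longrightarrow> \<exists>B\<in>bases. card B \<le> r \<and> \<not> T \<subseteq> B"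
    and "t \<le> card V"
  shows "\<exists>\<X>. finite \<X> \<and> card \<X> \<le> (r choose t) * r * k ^ j \<and> (\<forall>X\<in>\<X>. finite X \<and> card X = t + 1 + j)
    \<and> (\<forall>B\<in>bases. t + 1 + j \<le> card B \<longrightarrow> (\<exists>X\<in>\<X>. X \<subseteq> B))"
proof (induction j)
  case 0
  obtain T0 where "T0 \<subseteq> V" "card T0 = t"
    using obtain_subset_with_card_n[OF assms(2)] by blast
  then obtain S where S: "S \<in> bases" "card S \<le> r"
    using no_kernel by blast
  then have "S \<in> U" by (simp add: base_member)
  have "\<exists>Y. \<forall>T. T \<subseteq> V \<and> card T = t \<longrightarrow> Y T \<in> bases \<and> card (Y T) \<le> r \<and> \<not> T \<subseteq> Y T"
    using no_kernel by (intro choice) blast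
  then obtain Y where Y: "\<And>T. T \<subseteq> V \<Longrightarrow> card T = t \<Longrightarrow> Y T \<in> bases \<and> card (Y T) \<le> r \<and> \<not> T \<subseteq> Y T"
    by blast
  define \<T> where "\<T> = {T. T \<subseteq> S \<and> card T = t}"
  have fS: "finite S" using \<open>S \<in> U\<close> by (rule finite_member)
  have f\<T>: "finite \<T>" using fS by (simp add: \<T>_def)
  have TV: "T \<subseteq> V" "card T = t" "finite T" if "T \<in> \<T>" for T
    using that member_subset[OF \<open>S \<in> U\<close>] fS finite_subset by (auto simp: \<T>_def)
  define \<X> where "\<X> = (\<Union>T\<in>\<T>. (\<lambda>v. insert v T) ` (Y T - T))"
  have YU: "Y T \<in> U" "finite (Y T)" if "T \<in> \<T>" for T
  proof -
    show "Y T \<in> U"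
      using Y[OF TV(1)[OF that] TV(2)[OF that]] base_member by blast
    then show "finite (Y T)"
      by (rule finite_member)
  qed
  have "card \<X> \<le> (\<Sum>T\<in>\<T>. card ((\<lambda>v. insert v T) ` (Y T - T)))"
    unfolding \<X>_def using f\<T> by (rule card_UN_le)
  also have "\<dots> \<le> (\<Sum>T\<in>\<T>. r)"
  proof (rule sum_mono)
    fix T assume T: "T \<in> \<T>"
    have "card ((\<lambda>v. insert v T) ` (Y T - T)) \<le> card (Y T - T)"
      using YU[OF T] by (intro card_image_le) simp
    also have "\<dots> \<le> card (Y T)"
      using YU[OF T] by (intro card_mono) auto
    also have "\<dots> \<le> r" using Y TV[OF T] by blast
    finally show "card ((\<lambda>v. insert v T) ` (Y T - T)) \<le> r" .
  qed
  also have "\<dots> = (card S choose t) * r"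
    by (simp add: \<T>_def n_subsets[OF fS])
  also have "\<dots> \<le> (r choose t) * r"
    using S(2) by (intro mult_right_mono binomial_right_mono) simp_all
  finally have "card \<X> \<le> (r choose t) * r" .
  moreover have "finite \<X>"
    unfolding \<X>_def using f\<T> YU by blast
  moreover have "\<forall>X\<in>\<X>. finite X \<and> card X = t + 1 + 0"
    using TV by (auto simp: \<X>_def)
  moreover have "\<exists>X\<in>\<X>. X \<subseteq> B" if B: "B \<in> bases" for B
  proof -
    have "t \<le> card (B \<inter> S)"
      using B S base_member inter by blast
    then obtain T where T: "T \<subseteq> B \<inter> S" "card T = t"
      using obtain_subset_with_card_n by blast
    then have "T \<in> \<T>" by (auto simp: \<T>_def)
    note T' = TV[OF this] and YT = YU[OF this]
    have "T \<inter> Y T \<subset> T"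
      using Y T' by blast
    then have "card (T \<inter> Y T) < t"
      using psubset_card_mono[OF T'(3)] T'(2) by metis
    then obtain v where "v \<in> Y T - T" "v \<in> B"
      using branch[OF base_member[OF B] YT(1)] by blast
    then show ?thesis
      using T \<open>T \<in> \<T>\<close> by (auto simp: \<X>_def intro!: bexI[of _ T])
  qed
  ultimately show ?case by auto
next
  case (Suc j)
  then obtain \<X> where \<X>: "finite \<X>" "card \<X> \<le> (r choose t) * r * k ^ j"
    "\<And>X. X \<in> \<X> \<Longrightarrow> finite X \<and> card X = t + 1 + j"
    "\<And>B. B \<in> bases \<Longrightarrow> t + 1 + j \<le> card B \<Longrightarrow> \<exists>X\<in>\<X>. X \<subseteq> B"
    by auto
  define \<X>0 where "\<X>0 = {X \<in> \<X>. \<exists>Y\<in>U. card (X \<inter> Y) < t}"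
  have "\<exists>Y. \<forall>X. X \<in> \<X>0 \<longrightarrow> Y X \<in> U \<and> card (X \<inter> Y X) < t"
    by (intro choice) (auto simp: \<X>0_def)
  then obtain Y where Y: "\<And>X. X \<in> \<X>0 \<Longrightarrow> Y X \<in> U \<and> card (X \<inter> Y X) < t"
    by blast
  have fY: "finite (Y X)" if "X \<in> \<X>0" for X
    using Y that finite_member by blast
  have f0: "finite \<X>0" using \<X>(1) by (simp add: \<X>0_def)
  define \<Y> where "\<Y> = (\<Union>X\<in>\<X>0. (\<lambda>v. insert v X) ` (Y X - X))"
  have "card \<Y> \<le> (\<Sum>X\<in>\<X>0. card ((\<lambda>v. insert v X) ` (Y X - X)))"
    unfolding \<Y>_def using f0 by (rule card_UN_le)
  also have "\<dots> \<le> (\<Sum>X\<in>\<X>0. k)"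
  proof (rule sum_mono)
    fix X assume X: "X \<in> \<X>0"
    have "card ((\<lambda>v. insert v X) ` (Y X - X)) \<le> card (Y X - X)"
      using fY[OF X] by (intro card_image_le) simp
    also have "\<dots> \<le> card (Y X)"
      using fY[OF X] by (intro card_mono) auto
    also have "\<dots> \<le> k" using Y[OF X] member_card by blast
    finally show "card ((\<lambda>v. insert v X) ` (Y X - X)) \<le> k" .
  qed
  also have "\<dots> = card \<X>0 * k"
    by simp
  also have "\<dots> \<le> card \<X> * k"
    using \<X>(1) by (intro mult_right_mono card_mono) (auto simp: \<X>0_def)
  also have "\<dots> \<le> (r choose t) * r * k ^ Suc j"
    using mult_right_mono[OF \<X>(2), of k] by (simp add: ac_simps)
  finally have "card \<Y> \<le> (r choose t) * r * k ^ Suc j" .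
  moreover have "finite \<Y>"
    unfolding \<Y>_def using f0 fY by blast
  moreover have "\<forall>X\<in>\<Y>. finite X \<and> card X = t + 1 + Suc j"
    using \<X>(3) by (auto simp: \<Y>_def \<X>0_def)
  moreover have "\<exists>X\<in>\<Y>. X \<subseteq> B" if B: "B \<in> bases" "t + 1 + Suc j \<le> card B" for B
  proof -
    obtain X where X: "X \<in> \<X>" "X \<subseteq> B"
      using \<X>(4)[OF B(1)] B(2) by auto
    have "X \<noteq> B" using \<X>(3)[OF X(1)] B(2) by auto
    then obtain Y' where "Y' \<in> U" "card (X \<inter> Y') < t"
      using proper_subset_of_base[OF B(1)] X(2) by blast
    then have X0: "X \<in> \<X>0" using X by (auto simp: \<X>0_def)
    then obtain v where "v \<in> Y X - X" "v \<in> B"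
      using branch[OF base_member[OF B(1)]] Y by metis
    then show ?thesis
      using X X0 by (auto simp: \<Y>_def intro!: bexI[of _ X])
  qed
  ultimately show ?case by blast
qed

lemma card_bases_of_size:
  assumes "\<And>T. T \<subseteq> V \<Longrightarrow> card T = t \<Longrightarrow> \<exists>B\<in>bases. card B \<le> r \<and> \<not> T \<subseteq> B"
    and "t \<le> card V" "t < l"
  shows "card {B \<in> bases. card B = l} \<le> (r choose t) * r * k ^ (l - t - 1)"
proof -
  obtain \<X> where \<X>: "finite \<X>" "card \<X> \<le> (r choose t) * r * k ^ (l - t - 1)"
    "\<And>X. X \<in> \<X> \<Longrightarrow> finite X \<and> card X = t + 1 + (l - t - 1)"
    "\<And>B. B \<in> bases \<Longrightarrow> t + 1 + (l - t - 1) \<le> card B \<Longrightarrow> \<exists>X\<in>\<X>. X \<subseteq> B"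
    using branching_family[OF assms(1,2), of "l - t - 1"] by blast
  have "{B \<in> bases. card B = l} \<subseteq> \<X>"
  proof clarify
    fix B assume B: "B \<in> bases" "l = card B"
    then obtain X where X: "X \<in> \<X>" "X \<subseteq> B"
      using \<X>(4)[of B] assms(3) by auto
    then have "X = B"
      using \<X>(3)[OF X(1)] B assms(3) finite_member[OF base_member]
      by (intro card_subset_eq) auto
    then show "B \<in> \<X>" using X by simp
  qed
  then show ?thesis
    using \<X>(1,2) card_mono le_trans by blast
qed

text \<open>
  If the member \<open>F\<close> contains a base \<open>B\<close> of size \<open>l\<close>, then \<open>F \<inter> F'\<close> meets \<open>B\<close> in the set
  \<open>B \<inter> F'\<close> of size at least \<open>t\<close>, and only the \<open>k - l\<close> points of \<open>F - B\<close> remain for the rest. When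
  no base of size at least \<open>r\<close> is available on either side, \<open>T\<close> lies in both members; the bound
  \<open>k - 1\<close> on the size of \<open>F \<inter> F'\<close> comes from \<open>F \<noteq> F'\<close>.
\<close>

lemma card_intersections_le:
  assumes "\<F> \<subseteq> U" "\<And>F. F \<in> \<F> \<Longrightarrow> card F = k"
    and T: "T \<subseteq> V" "card T = t" "\<And>B. B \<in> bases \<Longrightarrow> card B < r \<Longrightarrow> T \<subseteq> B"
  shows "card (intersections \<F>) \<le> binom_sum (card V - t) (k - 1 - t)
    + (\<Sum>l\<in>{r..k}. card {B \<in> bases. card B = l} * (binom_sum l (l - t) * binom_sum (card V - l) (k - l)))"
proof -
  (* P covers the intersections containing T, and R B those of a member containing B. *)
  define P where "P = (\<lambda>Z. T \<union> Z) ` {Z. Z \<subseteq> V - T \<and> card Z \<le> k - 1 - t}"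
  define R where "R = (\<lambda>B. (\<lambda>(Y, Z). Y \<union> Z) `
    ({Y. Y \<subseteq> B \<and> t \<le> card Y} \<times> {Z. Z \<subseteq> V - B \<and> card Z \<le> k - card B}))"
  define L where "L = (\<lambda>l. {B \<in> bases. card B = l})"
  have finL: "finite (L l)" for l
    using finite_bases by (simp add: L_def)
  have finT: "finite T" using T(1) finite_V finite_subset by blast
  have covered: "intersections \<F> \<subseteq> P \<union> (\<Union>l\<in>{r..k}. \<Union>B\<in>L l. R B)"
  proof
    fix I assume "I \<in> intersections \<F>"
    then obtain F F' where F: "F \<in> \<F>" "F' \<in> \<F>" "F \<noteq> F'" and I: "I = F \<inter> F'"
      by (auto simp: intersections_def)
    have U: "F \<in> U" "F' \<in> U" and k: "card F = k" "card F' = k"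
      using F assms by auto
    note fin = finite_member[OF U(1)] finite_member[OF U(2)]
    obtain B where B: "B \<in> bases" "B \<subseteq> F" using base_below[OF U(1)] .
    obtain B' where B': "B' \<in> bases" "B' \<subseteq> F'" using base_below[OF U(2)] .
    have large: "I \<in> (\<Union>l\<in>{r..k}. \<Union>B\<in>L l. R B)"
      if G: "G \<in> U" "G' \<in> U" "card G = k" "I = G \<inter> G'" and C: "C \<in> bases" "C \<subseteq> G" "r \<le> card C"
      for G G' C
    proof -
      have CU: "C \<in> U" using C(1) by (rule base_member)
      have finC: "finite C" "finite G" using CU G(1) finite_member by auto
      have "t \<le> card (C \<inter> G')" using CU G(2) by (rule inter)
      then have 1: "t \<le> card (I \<inter> C)" using C(2) G(4) by (metis inf.absorb_iff2 inf.assoc inf.commute)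
      have "card (I - C) \<le> card (G - C)"
        using finC G(4) by (intro card_mono) auto
      also have "\<dots> = k - card C"
        using finC C(2) G(3) by (simp add: card_Diff_subset)
      finally have 2: "card (I - C) \<le> k - card C" .
      have "I - C \<subseteq> V - C" using member_subset[OF G(1)] G(4) by auto
      then have "I \<in> R C"
        unfolding R_def using 1 2 by (intro image_eqI[of _ _ "(I \<inter> C, I - C)"]) auto
      moreover have "card C \<in> {r..k}" using C(3) member_card[OF CU] by simp
      ultimately show ?thesis using C(1) by (auto simp: L_def)
    qed
    consider "r \<le> card B" | "r \<le> card B'" | "card B < r" "card B' < r"
      by linarith
    then show "I \<in> P \<union> (\<Union>l\<in>{r..k}. \<Union>B\<in>L l. R B)"
    proof cases
      case 1
      then show ?thesis using large[OF U k(1) I B] by blast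
    next
      case 2
      then show ?thesis using large[OF U(2,1) k(2) _ B'] I by blast
    next
      case 3
      then have "T \<subseteq> I" using T(3) B B' I by blast
      have "I \<subset> F"
        using F(3) I fin k by (metis card_subset_eq inf_le1 inf.absorb_iff1 psubsetI)
      then have "card I < k" using psubset_card_mono[OF fin(1)] k by metis
      moreover have "card (I - T) = card I - t"
        using \<open>T \<subseteq> I\<close> finT T(2) by (simp add: card_Diff_subset)
      moreover have "I - T \<subseteq> V - T" using member_subset[OF U(1)] I by auto
      ultimately have "I \<in> P"
        unfolding P_def using \<open>T \<subseteq> I\<close> by (intro image_eqI[of _ _ "I - T"]) auto
      then show ?thesis by blast
    qed
  qed
  have finVB: "finite (V - B)" for B using finite_V by simp
  have cardP: "card P \<le> binom_sum (card V - t) (k - 1 - t)"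
  proof -
    have "card P \<le> card {Z. Z \<subseteq> V - T \<and> card Z \<le> k - 1 - t}"
      unfolding P_def using finVB by (intro card_image_le) simp
    also have "\<dots> = binom_sum (card V - t) (k - 1 - t)"
      using T finT by (simp add: card_small_subsets[OF finVB] card_Diff_subset)
    finally show ?thesis .
  qed
  have finR: "finite (R B)" if "B \<in> L l" for B l
  proof -
    have "finite B" using that finite_member[OF base_member] by (simp add: L_def)
    then show ?thesis unfolding R_def using finVB by (intro finite_imageI finite_cartesian_product) simp_all
  qed
  have cardR: "card (R B) \<le> binom_sum l (l - t) * binom_sum (card V - l) (k - l)" if "B \<in> L l" for B l
  proof -
    have B: "finite B" "card B = l" "B \<subseteq> V"
      using that finite_member[OF base_member] member_subset[OF base_member] by (auto simp: L_def)
    have "card (R B) \<le> card ({Y. Y \<subseteq> B \<and> t \<le> card Y} \<times> {Z. Z \<subseteq> V - B \<and> card Z \<le> k - card B})"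
      unfolding R_def using finVB B by (intro card_image_le finite_cartesian_product) simp_all
    also have "\<dots> = card {Y. Y \<subseteq> B \<and> t \<le> card Y} * binom_sum (card (V - B)) (k - card B)"
      by (simp add: card_cartesian_product card_small_subsets[OF finVB])
    also have "\<dots> \<le> binom_sum l (l - t) * binom_sum (card V - l) (k - l)"
      using card_large_subsets[OF B(1), of t] B by (simp add: card_Diff_subset)
    finally show ?thesis .
  qed
  have "card (intersections \<F>) \<le> card (P \<union> (\<Union>l\<in>{r..k}. \<Union>B\<in>L l. R B))"
  proof (rule card_mono[OF _ covered])
    have "finite P" unfolding P_def using finVB by (intro finite_imageI) simp
    then show "finite (P \<union> (\<Union>l\<in>{r..k}. \<Union>B\<in>L l. R B))"
      using finL finR by blast
  qed
  also have "\<dots> \<le> card P + card (\<Union>l\<in>{r..k}. \<Union>B\<in>L l. R B)"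
    by (rule card_Un_le)
  also have "card (\<Union>l\<in>{r..k}. \<Union>B\<in>L l. R B) \<le> (\<Sum>l\<in>{r..k}. card (\<Union>B\<in>L l. R B))"
    by (rule card_UN_le) simp
  also have "\<dots> \<le> (\<Sum>l\<in>{r..k}. card (L l) * (binom_sum l (l - t) * binom_sum (card V - l) (k - l)))"
  proof (rule sum_mono)
    fix l
    have "card (\<Union>B\<in>L l. R B) \<le> (\<Sum>B\<in>L l. card (R B))"
      using finL by (rule card_UN_le)
    also have "\<dots> \<le> (\<Sum>B\<in>L l. binom_sum l (l - t) * binom_sum (card V - l) (k - l))"
      using cardR by (rule sum_mono)
    finally show "card (\<Union>B\<in>L l. R B) \<le> card (L l) * (binom_sum l (l - t) * binom_sum (card V - l) (k - l))"
      by simp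
  qed
  finally show ?thesis
    using cardP by (simp add: L_def)
qed

text \<open>
  All bases of size at most \<open>t + 1\<close> have exactly \<open>t + 1\<close> points, since a base with \<open>t\<close> points
  would be contained in every member. Two of them share a \<open>t\<close>-set \<open>D\<close>; a third that does not
  contain \<open>D\<close> is forced into their union \<open>W\<close>. The three bases are \<open>W\<close> minus one point each.
\<close>

lemma concentrated_on_small_set:
  assumes no_kernel: "\<And>T. T \<subseteq> V \<Longrightarrow> card T = t \<Longrightarrow> \<exists>B\<in>bases. card B \<le> t + 1 \<and> \<not> T \<subseteq> B"
    and "t \<le> card V"
  obtains W where "W \<subseteq> V" "card W = t + 2" "\<And>F. F \<in> U \<Longrightarrow> t + 1 \<le> card (F \<inter> W)"
proof -
  have size: "card B = t + 1" if B: "B \<in> bases" "card B \<le> t + 1" for B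
  proof (rule ccontr)
    assume "card B \<noteq> t + 1"
    then have c: "card B = t"
      using B card_member_ge[OF base_member] by (metis Suc_eq_plus1 le_SucE le_antisym)
    have BU: "B \<in> U" using B base_member by blast
    then obtain B' where B': "B' \<in> bases" "\<not> B \<subseteq> B'"
      using no_kernel[OF member_subset c] by blast
    have "B \<inter> B' \<subset> B" using B' by blast
    then have "card (B \<inter> B') < t"
      using psubset_card_mono[OF finite_member[OF BU]] c by metis
    then show False
      using inter[OF BU base_member[OF B'(1)]] by simp
  qed
  obtain T0 where "T0 \<subseteq> V" "card T0 = t"
    using obtain_subset_with_card_n[OF assms(2)] by blast
  then obtain B1 where B1: "B1 \<in> bases" "card B1 \<le> t + 1"
    using no_kernel by blast
  then have U1: "B1 \<in> U" and c1: "card B1 = t + 1" and f1: "finite B1"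
    using base_member size finite_member by auto
  obtain T1 where T1: "T1 \<subseteq> B1" "card T1 = t"
    using obtain_subset_with_card_n[of t B1] c1 by auto
  then obtain B2 where B2: "B2 \<in> bases" "card B2 \<le> t + 1" "\<not> T1 \<subseteq> B2"
    using no_kernel member_subset[OF U1] by (metis order_trans)
  then have U2: "B2 \<in> U" and c2: "card B2 = t + 1" and f2: "finite B2"
    using base_member size finite_member by auto
  define D where "D = B1 \<inter> B2"
  have "D \<subset> B1" using T1 B2 by (auto simp: D_def)
  then have "card D < t + 1" using psubset_card_mono[OF f1] c1 by metis
  then have cD: "card D = t"
    using inter[OF U1 U2] by (simp add: D_def)
  have fD: "finite D" using f1 by (simp add: D_def)
  have "card (B1 - D) = 1" "card (B2 - D) = 1"
    using cD c1 c2 fD card_Diff_subset[of D B1] card_Diff_subset[of D B2] by (auto simp: D_def)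
  then obtain a b where "B1 - D = {a}" "B2 - D = {b}"
    by (metis card_1_singletonE)
  then have ab: "B1 = insert a D" "B2 = insert b D" "a \<notin> D" "b \<notin> D" "a \<noteq> b"
    by (auto simp: D_def)
  obtain B3 where B3: "B3 \<in> bases" "card B3 \<le> t + 1" "\<not> D \<subseteq> B3"
    using no_kernel[of D] cD member_subset[OF U1] by (auto simp: D_def)
  then have U3: "B3 \<in> U" and c3: "card B3 = t + 1" and f3: "finite B3"
    using base_member size finite_member by auto
  obtain d where d: "d \<in> D" "d \<notin> B3" using B3 by blast
  have full: "B - {d} \<subseteq> B3" if "B \<in> U" "card B = t + 1" "d \<in> B" for B
  proof -
    have fB: "finite B" using that finite_member by blast
    have "B \<inter> B3 = B - {d}"
    proof (rule card_subset_eq)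
      show "finite (B - {d})" using fB by simp
      show sub: "B \<inter> B3 \<subseteq> B - {d}" using d by blast
      have "card (B - {d}) = t" using that fB by simp
      then show "card (B \<inter> B3) = card (B - {d})"
        using inter[OF that(1) U3] card_mono[OF _ sub] fB by simp
    qed
    then show ?thesis by blast
  qed
  define W where "W = insert a (insert b D)"
  have cW: "card W = t + 2" and fW: "finite W"
    using ab fD cD by (auto simp: W_def)
  have "W - {d} \<subseteq> B3"
    using full[OF U1 c1] full[OF U2 c2] d ab by (auto simp: W_def)
  moreover have "card (W - {d}) = card B3"
    using cW fW d c3 by (simp add: W_def)
  ultimately have W3: "W - {d} = B3"
    using f3 by (simp add: card_subset_eq)
  show thesis
  proof (rule that)
    show "W \<subseteq> V" using member_subset[OF U1] member_subset[OF U2] ab by (auto simp: W_def)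
    show "card W = t + 2" by (rule cW)
    fix F assume F: "F \<in> U"
    show "t + 1 \<le> card (F \<inter> W)"
    proof (rule ccontr)
      assume "\<not> t + 1 \<le> card (F \<inter> W)"
      then have small: "card (F \<inter> W) \<le> t" by simp
      have missing: "x \<notin> F" if "x \<in> W" "W - {x} \<in> U" for x
      proof
        assume "x \<in> F"
        then have "F \<inter> (W - {x}) \<subset> F \<inter> W" using that by blast
        then have "card (F \<inter> (W - {x})) < card (F \<inter> W)"
          using fW by (intro psubset_card_mono) auto
        then show False using inter[OF F that(2)] small by simp
      qed
      have "W - {b} = B1" "W - {a} = B2" using ab by (auto simp: W_def)
      then have "a \<notin> F" "b \<notin> F" "d \<notin> F"
        using missing[of a] missing[of b] missing[of d] U1 U2 U3 W3 d by (auto simp: W_def)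
      then have "F \<inter> W \<subseteq> D - {d}" by (auto simp: W_def)
      then have "card (F \<inter> W) \<le> card (D - {d})" using fD by (intro card_mono) auto
      also have "\<dots> < t" using d cD fD by (metis card_Diff1_less)
      finally have "card (F \<inter> W) < t" .
      moreover have "t \<le> card (F \<inter> (W - {d}))" using inter[OF F U3] W3 by simp
      moreover have "card (F \<inter> (W - {d})) \<le> card (F \<inter> W)"
        using fW by (intro card_mono) auto
      ultimately show False by simp
    qed
  qed
qed

text \<open>
  The exceptional \<open>t\<close>-set is taken for the largest possible threshold \<open>r\<close>: it then covers as many
  bases as possible, while maximality of \<open>r\<close> supplies, for each \<open>t\<close>-set, a base of size at most
  \<open>r\<close> not containing it, from which the branching starts. If \<open>r = k + 1\<close>, the \<open>t\<close>-set lies in all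
  members and the sum over \<open>l\<close> is empty.
\<close>

lemma card_intersections_le_if_kernel:
  assumes n: "3 * (t + 2) ^ 3 * k\<^sup>2 \<le> card V" and t: "0 < t" "t < k"
    and \<F>: "\<F> \<subseteq> U" "\<And>F. F \<in> \<F> \<Longrightarrow> card F = k"
    and kernel: "T0 \<subseteq> V" "card T0 = t" "\<And>B. B \<in> bases \<Longrightarrow> card B \<le> t + 1 \<Longrightarrow> T0 \<subseteq> B"
  shows "card (intersections \<F>) \<le> (t + 2 choose 2) * binom_sum (card V - t - 2) (k - t - 1)"
proof -
  define n where "n = card V"
  define c where "c = t + 2 choose 2"
  define S where "S = binom_sum (n - t - 2) (k - t - 1)"
  define P where "P = (\<lambda>r. \<exists>T\<subseteq>V. card T = t \<and> (\<forall>B\<in>bases. card B < r \<longrightarrow> T \<subseteq> B))"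
  define r where "r = Max {r \<in> {t + 2..k + 1}. P r}"
  have "P (t + 2)"
    unfolding P_def using kernel by (intro exI[of _ T0]) auto
  then have "t + 2 \<in> {r \<in> {t + 2..k + 1}. P r}" using t by simp
  then have "r \<in> {r \<in> {t + 2..k + 1}. P r}"
    unfolding r_def by (intro Max_in) auto
  then have r: "t + 2 \<le> r" "r \<le> k + 1" "P r" by auto
  have no_kernel: "\<exists>B\<in>bases. card B \<le> r \<and> \<not> T \<subseteq> B" if "r \<le> k" "T \<subseteq> V" "card T = t" for T
  proof (rule ccontr)
    assume "\<not> ?thesis"
    then have "P (r + 1)" unfolding P_def using that by (intro exI[of _ T]) auto
    then have "r + 1 \<le> r"
      unfolding r_def using that r(1) by (intro Max_ge) (auto simp: r_def)
    then show False by simp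
  qed
  have "1 * k\<^sup>2 \<le> 3 * (t + 2) ^ 3 * k\<^sup>2"
    by (rule mult_right_mono) simp_all
  then have "k\<^sup>2 \<le> n" unfolding n_def mult_1 using assms(1) by (rule order_trans)
  moreover have "2 * k \<le> k\<^sup>2" using t by (simp add: power2_eq_square)
  ultimately have kn: "2 * k \<le> n" by simp
  obtain T where T: "T \<subseteq> V" "card T = t" "\<And>B. B \<in> bases \<Longrightarrow> card B < r \<Longrightarrow> T \<subseteq> B"
    using r(3) unfolding P_def by blast
  define f where "f = (\<lambda>l. card {B \<in> bases. card B = l} * (binom_sum l (l - t) * binom_sum (n - l) (k - l)))"
  have total: "card (intersections \<F>) \<le> binom_sum (n - t) (k - 1 - t) + (\<Sum>l\<in>{r..k}. f l)"
    using card_intersections_le[OF \<F> T] by (simp add: f_def n_def)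
  have star: "binom_sum (n - t) (k - 1 - t) \<le> 2 * S"
  proof -
    have "n - t - 2 + 2 = n - t" using kn t by simp
    moreover have "3 * binom_sum (n - t - 2) (k - t - 1 - 1) \<le> binom_sum (n - t - 2) (k - t - 1)" if "0 < k - t - 1"
    proof -
      have "3 * binom_sum (n - t - 2) (k - t - 1 - 1) \<le> 3 * (t + 2) ^ 3 * k * binom_sum (n - t - 2) (k - t - 1 - 1)"
        using t by (intro mult_right_mono) simp_all
      also have "\<dots> \<le> binom_sum (n - t - 2) (Suc (k - t - 1 - 1))"
        using n t(1) that by (intro binom_sum_grows) (simp_all add: n_def)
      finally show ?thesis by (simp only: Suc_diff_1[OF that])
    qed
    ultimately show ?thesis
      using binom_sum_add_2_le[of "k - t - 1" "n - t - 2"] by (simp add: S_def)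
  qed
  have tail: "real (\<Sum>l\<in>{r..k}. f l) \<le> 7 / 24 * (real c * real S)"
  proof -
    have term_le: "real (f l) \<le> 7 / 27 * c * S * (1 / 9) ^ (l - (t + 2))" if l: "l \<in> {r..k}" for l
    proof -
      have "card {B \<in> bases. card B = l} \<le> (r choose t) * r * k ^ (l - t - 1)"
        using no_kernel l r(1) kn t by (intro card_bases_of_size) (auto simp: n_def)
      also have "\<dots> \<le> (l choose t) * l * k ^ (l - t - 1)"
        using l by (intro mult_mono binomial_right_mono) simp_all
      finally have "f l \<le> (l choose t) * l * k ^ (l - t - 1) * (binom_sum l (l - t) * binom_sum (n - l) (k - l))"
        unfolding f_def by (rule mult_right_mono) simp
      then have "real (f l) \<le> real ((l choose t) * l * k ^ (l - t - 1) * (binom_sum l (l - t) * binom_sum (n - l) (k - l)))"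
        by (rule of_nat_mono)
      also have "\<dots> \<le> 7 / 27 * c * (1 / 9) ^ (l - (t + 2)) * S"
        using tail_term_bound[OF n t(1), of l] l r(1) unfolding n_def c_def S_def by simp
      finally show ?thesis by (simp add: mult_ac)
    qed
    have "real (\<Sum>l\<in>{r..k}. f l) \<le> (\<Sum>l\<in>{r..k}. 7 / 27 * c * S * (1 / 9) ^ (l - (t + 2)))"
      using term_le by (simp only: of_nat_sum) (rule sum_mono)
    also have "\<dots> \<le> (\<Sum>l\<in>{t + 2..<t + 2 + k}. 7 / 27 * c * S * (1 / 9) ^ (l - (t + 2)))"
      using r(1) by (intro sum_mono2) auto
    also have "\<dots> = 7 / 27 * c * S * (\<Sum>i<k. (1 / 9) ^ i)"
      unfolding sum_distrib_left
      by (rule sum.reindex_bij_witness[of _ "\<lambda>i. i + (t + 2)" "\<lambda>l. l - (t + 2)"]) auto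
    also have "\<dots> \<le> 7 / 27 * c * S * (9 / 8)"
      by (intro mult_left_mono) (simp_all add: sum_gp_strict)
    finally show ?thesis by (simp add: mult_ac)
  qed
  have "3 \<le> c"
  proof -
    have "3 choose 2 \<le> c" unfolding c_def using t by (intro binomial_right_mono) simp
    then show ?thesis by (simp add: choose_two)
  qed
  then have "3 * real S \<le> real c * real S"
    by (intro mult_right_mono) simp_all
  moreover have "real (card (intersections \<F>)) \<le> 2 * real S + real (\<Sum>l\<in>{r..k}. f l)"
    using total star by linarith
  ultimately have "real (card (intersections \<F>)) \<le> real (c * S)"
    using tail unfolding of_nat_mult by linarith
  then show ?thesis
    by (simp only: of_nat_le_iff c_def S_def n_def)
qed

end

lemma saturated_extension:
  assumes "finite V" "\<And>F. F \<in> \<F> \<Longrightarrow> F \<subseteq> V \<and> card F \<le> k" "t_intersecting t \<F>"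
  obtains U where "saturated_family V k t U" "\<F> \<subseteq> U"
proof -
  define \<C> where "\<C> = {U. \<F> \<subseteq> U \<and> U \<subseteq> Pow V \<and> (\<forall>X\<in>U. card X \<le> k) \<and> t_intersecting t U}"
  have "finite \<C>"
    using assms(1) by (intro finite_subset[of \<C> "Pow (Pow V)"]) (auto simp: \<C>_def)
  moreover have "\<F> \<in> \<C>" using assms by (auto simp: \<C>_def)
  ultimately obtain U where U: "U \<in> \<C>" "\<And>U'. U' \<in> \<C> \<Longrightarrow> U \<subseteq> U' \<Longrightarrow> U = U'"
    using finite_has_maximal2[of \<C> \<F>] by auto
  then have U': "\<F> \<subseteq> U" "U \<subseteq> Pow V" "\<forall>X\<in>U. card X \<le> k" "t_intersecting t U"
    by (simp_all add: \<C>_def)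
  have "saturated_family V k t U"
  proof
    fix X assume X: "X \<subseteq> V" "card X \<le> k" "t \<le> card X" "\<And>Y. Y \<in> U \<Longrightarrow> t \<le> card (X \<inter> Y)"
    have "t \<le> card (Y \<inter> X)" if "Y \<in> U" for Y
      using X(4)[OF that] by (simp add: Int_commute)
    then have "t_intersecting t (insert X U)"
      using U'(4) X(3,4) unfolding t_intersecting_def by simp
    then have "insert X U \<in> \<C>"
      using U' X(1,2) unfolding \<C>_def by blast
    then show "X \<in> U" using U(2)[of "insert X U"] by blast
  qed (use U' assms(1) in \<open>auto simp: t_intersecting_def\<close>)
  then show thesis
    using U'(1) by (rule that)
qed

section \<open>The extremal family\<close>

lemma intersections_mono: "\<F> \<subseteq> \<G> \<Longrightarrow> intersections \<F> \<subseteq> intersections \<G>"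
  by (auto simp: intersections_def)

lemma finite_intersections:
  assumes "finite \<F>"
  shows "finite (intersections \<F>)"
proof -
  have "intersections \<F> \<subseteq> (\<lambda>(F, F'). F \<inter> F') ` (\<F> \<times> \<F>)"
    by (auto simp: intersections_def)
  then show ?thesis
    using assms finite_subset by blast
qed

lemma card_intersections_image:
  assumes f: "inj_on f V" and \<F>: "\<F> \<subseteq> Pow V"
  shows "card (intersections ((`) f ` \<F>)) = card (intersections \<F>)"
proof -
  have inj: "inj_on ((`) f) (Pow V)"
    using f by (rule inj_on_image_Pow)
  have int: "f ` (F \<inter> F') = f ` F \<inter> f ` F'" if "F \<in> \<F>" "F' \<in> \<F>" for F F'
    using that \<F> by (intro inj_on_image_Int[OF f]) auto
  have ne: "f ` F \<noteq> f ` F'" if "F \<in> \<F>" "F' \<in> \<F>" "F \<noteq> F'" for F F'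
    using inj_on_eq_iff[OF inj, of F F'] that \<F> by blast
  have "intersections ((`) f ` \<F>) = (`) f ` intersections \<F>"
  proof (intro equalityI subsetI)
    fix I assume "I \<in> intersections ((`) f ` \<F>)"
    then obtain F F' where F: "F \<in> \<F>" "F' \<in> \<F>" "f ` F \<noteq> f ` F'" and I: "I = f ` F \<inter> f ` F'"
      unfolding intersections_def by blast
    then have "F \<inter> F' \<in> intersections \<F>"
      unfolding intersections_def by blast
    then show "I \<in> (`) f ` intersections \<F>"
      using I int[OF F(1,2)] by blast
  next
    fix I assume "I \<in> (`) f ` intersections \<F>"
    then obtain F F' where F: "F \<in> \<F>" "F' \<in> \<F>" "F \<noteq> F'" and I: "I = f ` (F \<inter> F')"
      unfolding intersections_def by blast
    then show "I \<in> intersections ((`) f ` \<F>)"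
      unfolding I int[OF F(1,2)] intersections_def using F(1,2) ne[OF F] by blast
  qed
  moreover have "inj_on ((`) f) (intersections \<F>)"
    using \<F> by (intro inj_on_subset[OF inj]) (auto simp: intersections_def)
  ultimately show ?thesis
    by (simp add: card_image)
qed

lemma finite_frankl_family: "finite (frankl_family n k t)"
proof -
  have "frankl_family n k t \<subseteq> Pow {1..n}"
    by (auto simp: frankl_family_def nsets_def)
  then show ?thesis
    by (rule finite_subset) simp
qed

text \<open>A permutation of \<open>{1..n}\<close> carrying \<open>W\<close> to \<open>{1..t + 2}\<close> moves the family into the extremal one.\<close>

lemma card_intersections_le_frankl_if_concentrated:
  assumes "\<F> \<subseteq> nsets {1..n} k" "W \<subseteq> {1..n}" "card W = t + 2"
    and "\<And>F. F \<in> \<F> \<Longrightarrow> t + 1 \<le> card (F \<inter> W)"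
  shows "card (intersections \<F>) \<le> card (intersections (frankl_family n k t))"
proof -
  have finW: "finite W" using assms(2) finite_subset by blast
  have "card W \<le> card {1..n}"
    using assms(2) by (intro card_mono) simp_all
  then have tn: "t + 2 \<le> n" using assms(3) by simp
  obtain g where g: "bij_betw g W {1..t + 2}"
    using finite_same_card_bij[OF finW, of "{1..t + 2}"] assms(3) by auto
  have "card ({1..n} - W) = card {t + 3..n}"
    using assms(2,3) finW by (simp add: card_Diff_subset)
  then obtain h where h: "bij_betw h ({1..n} - W) {t + 3..n}"
    using finite_same_card_bij[of "{1..n} - W" "{t + 3..n}"] by auto
  define f where "f = (\<lambda>x. if x \<in> W then g x else h x)"
  have fW: "bij_betw f W {1..t + 2}"
    using g by (rule bij_betw_cong[THEN iffD1, rotated]) (simp add: f_def)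
  have fV: "bij_betw f ({1..n} - W) {t + 3..n}"
    using h by (rule bij_betw_cong[THEN iffD1, rotated]) (simp add: f_def)
  have "bij_betw f (W \<union> ({1..n} - W)) ({1..t + 2} \<union> {t + 3..n})"
    by (rule bij_betw_combine[OF fW fV]) auto
  moreover have "W \<union> ({1..n} - W) = {1..n}" using assms(2) by blast
  moreover have "{1..t + 2} \<union> {t + 3..n} = {1..n}" using tn by auto
  ultimately have f: "bij_betw f {1..n} {1..n}" by simp
  then have inj: "inj_on f {1..n}" and onto: "f ` {1..n} = {1..n}"
    by (auto simp: bij_betw_def)
  have \<F>: "\<F> \<subseteq> Pow {1..n}" using assms(1) by (auto simp: nsets_def)
  have "(`) f ` \<F> \<subseteq> frankl_family n k t"
  proof clarify
    fix F assume F: "F \<in> \<F>"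
    then have sub: "F \<subseteq> {1..n}" and c: "card F = k" "finite F"
      using assms(1) by (auto simp: nsets_def)
    have injF: "inj_on f A" if "A \<subseteq> F" for A
      using inj_on_subset[OF inj] sub that by blast
    have "f ` (F \<inter> W) \<subseteq> f ` F \<inter> {1..t + 2}"
      using fW by (auto simp: bij_betw_def)
    then have "card (f ` (F \<inter> W)) \<le> card (f ` F \<inter> {1..t + 2})"
      by (intro card_mono) auto
    moreover have "card (f ` (F \<inter> W)) = card (F \<inter> W)"
      by (intro card_image injF) simp
    ultimately have "t + 1 \<le> card (f ` F \<inter> {1..t + 2})"
      using assms(4)[OF F] by simp
    moreover have "f ` F \<subseteq> {1..n}" using sub onto by blast
    moreover have "card (f ` F) = k" using c card_image[OF injF] by simp
    ultimately show "f ` F \<in> frankl_family n k t"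
      using c(2) by (simp add: frankl_family_def nsets_def)
  qed
  then have "card (intersections ((`) f ` \<F>)) \<le> card (intersections (frankl_family n k t))"
    by (intro card_mono finite_intersections finite_frankl_family intersections_mono)
  then show ?thesis
    by (simp only: card_intersections_image[OF inj \<F>])
qed

text \<open>
  Given a \<open>t\<close>-subset \<open>T\<close> of \<open>{1..t + 2}\<close> and a small outside set \<open>Z\<close>, the set \<open>T \<union> Z\<close> is the
  intersection of two members: add to it one of the two points of \<open>{1..t + 2} - T\<close> each, and fill
  up with disjoint outside sets \<open>D1\<close> and \<open>D2\<close>.
\<close>

lemma card_intersections_frankl_ge:
  assumes "t < k" "2 * k + t + 2 \<le> n"
  shows "(t + 2 choose 2) * binom_sum (n - t - 2) (k - t - 1) \<le> card (intersections (frankl_family n k t))"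
proof -
  define W where "W = {1..t + 2}"
  define N where "N = {t + 3..n}"
  have WN: "W \<inter> N = {}" "W \<union> N = {1..n}" "finite W" "finite N"
    using assms by (auto simp: W_def N_def)
  define \<P> where "\<P> = {T. T \<subseteq> W \<and> card T = t} \<times> {Z. Z \<subseteq> N \<and> card Z \<le> k - t - 1}"
  have "card \<P> = (t + 2 choose t) * binom_sum (n - t - 2) (k - t - 1)"
    unfolding \<P>_def card_cartesian_product n_subsets[OF WN(3)] card_small_subsets[OF WN(4)]
    by (simp add: W_def N_def)
  moreover have "t + 2 choose t = t + 2 choose 2"
    using binomial_symmetric[of t "t + 2"] by simp
  moreover have "inj_on (\<lambda>(T, Z). T \<union> Z) \<P>"
    using WN(1) by (auto simp: inj_on_def \<P>_def) blast+
  moreover have "(\<lambda>(T, Z). T \<union> Z) ` \<P> \<subseteq> intersections (frankl_family n k t)"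
  proof clarify
    fix T Z assume "(T, Z) \<in> \<P>"
    then have T: "T \<subseteq> W" "card T = t" and Z: "Z \<subseteq> N" "card Z \<le> k - t - 1"
      by (auto simp: \<P>_def)
    have fin: "finite T" "finite Z"
      using T Z WN finite_subset by blast+
    have "card (W - T) = 2"
      using T fin WN by (simp add: card_Diff_subset W_def)
    then obtain x y where xy: "W - T = {x, y}" "x \<noteq> y"
      by (meson card_2_iff)
    define d where "d = k - t - 1 - card Z"
    have cNZ: "card (N - Z) = n - t - 2 - card Z"
      using Z fin by (simp add: card_Diff_subset N_def)
    then have "d \<le> card (N - Z)" using assms by (simp add: d_def)
    then obtain D1 where D1: "D1 \<subseteq> N - Z" "card D1 = d" "finite D1"
      by (rule obtain_subset_with_card_n)
    have "card (N - Z - D1) = n - t - 2 - card Z - d"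
      using D1 cNZ by (simp add: card_Diff_subset)
    then have "d \<le> card (N - Z - D1)" using assms by (simp add: d_def)
    then obtain D2 where D2: "D2 \<subseteq> N - Z - D1" "card D2 = d" "finite D2"
      by (rule obtain_subset_with_card_n)
    have mem: "insert z T \<union> (Z \<union> D) \<in> frankl_family n k t"
      if z: "z \<in> W - T" and D: "D \<subseteq> N - Z" "card D = d" "finite D" for z D
    proof -
      have "card (Z \<union> D) = card Z + d"
        using D fin by (subst card_Un_disjoint) auto
      moreover have "insert z T \<inter> (Z \<union> D) = {}"
        using z D T Z WN(1) by blast
      ultimately have "card (insert z T \<union> (Z \<union> D)) = Suc t + (card Z + d)"
        using fin D z T by (subst card_Un_disjoint) auto
      also have "\<dots> = k" using Z(2) assms(1) by (simp add: d_def)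
      finally have 1: "card (insert z T \<union> (Z \<union> D)) = k" .
      have "(insert z T \<union> (Z \<union> D)) \<inter> W = insert z T"
        using z D T Z WN(1) by blast
      then have 2: "card ((insert z T \<union> (Z \<union> D)) \<inter> W) = t + 1"
        using z T fin by simp
      have 3: "insert z T \<union> (Z \<union> D) \<subseteq> {1..n}"
        using z D T Z WN(2) by blast
      show ?thesis
        using 1 2 3 fin D unfolding frankl_family_def nsets_def W_def by auto
    qed
    have "insert x T \<union> (Z \<union> D1) \<in> frankl_family n k t"
      using mem[of x D1] xy D1 by blast
    moreover have "insert y T \<union> (Z \<union> D2) \<in> frankl_family n k t"
      using mem[of y D2] xy D2 by blast
    moreover have "(insert x T \<union> (Z \<union> D1)) \<inter> (insert y T \<union> (Z \<union> D2)) = T \<union> Z"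
      using xy D1(1) D2(1) T(1) Z(1) WN(1) by blast
    moreover have "insert x T \<union> (Z \<union> D1) \<noteq> insert y T \<union> (Z \<union> D2)"
      using xy D2(1) Z(1) WN(1) by blast
    ultimately show "T \<union> Z \<in> intersections (frankl_family n k t)"
      unfolding intersections_def by blast
  qed
  ultimately show ?thesis
    using card_inj_on_le[OF _ _ finite_intersections[OF finite_frankl_family]] by metis
qed

section \<open>The maximum number of distinct intersections\<close>

theorem theorem1p8:
  fixes n k t :: nat and \<F> :: "nat set set"
  assumes "0 < n" and "0 < k" and "0 < t"
    and "k \<le> n" and "t < k"
    and "3 * (t + 2) ^ 3 * k ^ 2 \<le> n"
    and "\<F> \<subseteq> nsets {1..n} k"
    and "t_intersecting t \<F>"
  shows "card (intersections \<F>) \<le> card (intersections (frankl_family n k t))"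
proof -
  define V where "V = {1..n}"
  have cV: "card V = n" and finV: "finite V" by (simp_all add: V_def)
  have \<F>: "F \<subseteq> V" "card F = k" if "F \<in> \<F>" for F
    using that assms(7) by (auto simp: nsets_def V_def)
  then obtain U where U: "saturated_family V k t U" "\<F> \<subseteq> U"
    using saturated_extension[OF finV _ assms(8), of k] by (metis le_refl)
  interpret saturated_family V k t U by (rule U(1))
  show ?thesis
  proof (cases "\<exists>T\<subseteq>V. card T = t \<and> (\<forall>B\<in>bases. card B \<le> t + 1 \<longrightarrow> T \<subseteq> B)")
    case True
    then obtain T where "T \<subseteq> V" "card T = t" "\<And>B. B \<in> bases \<Longrightarrow> card B \<le> t + 1 \<Longrightarrow> T \<subseteq> B"
      by blast
    then have "card (intersections \<F>) \<le> (t + 2 choose 2) * binom_sum (n - t - 2) (k - t - 1)"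
      using card_intersections_le_if_kernel[OF _ assms(3,5) U(2)] assms(6) \<F>(2) cV by simp
    also have "\<dots> \<le> card (intersections (frankl_family n k t))"
    proof (rule card_intersections_frankl_ge[OF assms(5)])
      have "27 * k\<^sup>2 \<le> 3 * (t + 2) ^ 3 * k\<^sup>2"
        using power_mono[of 3 "t + 2" 3] assms(3) by (intro mult_right_mono) simp_all
      moreover have "k * 1 \<le> k\<^sup>2"
        unfolding power2_eq_square using assms(2) by (intro mult_left_mono) simp_all
      ultimately show "2 * k + t + 2 \<le> n"
        using assms(2,5,6) by linarith
    qed
    finally show ?thesis .
  next
    case False
    then have no_kernel: "\<exists>B\<in>bases. card B \<le> t + 1 \<and> \<not> T \<subseteq> B" if "T \<subseteq> V" "card T = t" for T
      using that by blast
    have "t \<le> card V" using assms(4,5) cV by simp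
    show ?thesis
    proof (rule concentrated_on_small_set[OF no_kernel \<open>t \<le> card V\<close>])
      fix W assume "W \<subseteq> V" "card W = t + 2" "\<And>F. F \<in> U \<Longrightarrow> t + 1 \<le> card (F \<inter> W)"
      then show ?thesis
        using U(2) assms(7) unfolding V_def
        by (intro card_intersections_le_frankl_if_concentrated[of _ _ _ W]) auto
    qed
  qed
qed

end
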